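(* Let $\mathcal F$ be a finite reduced collection of forbidden words over $\Sigma$ such that $\Sigma_{\mathcal F}$ is irreducible, let $\mathcal R=\{r_1(m_1),\dots,r_\ell(m_\ell)\}$ be a (possibly empty) reduced collection of repeated words for $\mathcal F$, and let $p\ge2$ be the length of the longest word in $\mathcal F\cup\mathcal R$. Then there exists a non-negative integer matrix $A$ indexed by $\mathcal L_{p-1}$ such that the associated edge shift $\Sigma_A$, with language $\mathcal L(\Sigma_A)$, satisfies: (i) $\mathcal L(\Sigma_A)\subseteq\Lambda^p$; (ii) the topological entropy of $\Sigma_A$ is $h_{\mathrm{top}}(\Sigma_A)=\lim_{n\to\infty}\frac1n\ln|\Lambda_n|$; (iii) $h_{\mathrm{top}}(\Sigma_A)>0$ if $\mathcal R\neq\emptyset$.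
   Context: Let $\Sigma$ be a finite symbol set. A word is a finite sequence over $\Sigma$. A finite collection of words is reduced if for any two distinct words in it neither is a (contiguous) subword of the other. $\mathcal F$ is a finite reduced collection of words of length at least $2$; $\Sigma_{\mathcal F}\subseteq\Sigma^{\mathbb N}$ is the set of one-sided sequences containing no word of $\mathcal F$ as a subword. A word is allowed if it is a subword of some sequence in $\Sigma_{\mathcal F}$; $\mathcal L_n$ ($n\ge1$) is the set of allowed words of length $n$. It is assumed that every symbol of $\Sigma$ is allowed and that $\Sigma_{\mathcal F}$ is irreducible: for all allowed words $u,v$ there is a word $w$ with $uwv$ allowed. A collection of repeated words is a finite reduced collection $\mathcal R=\{r_1,\dots,r_\ell\}$ of allowed words, each $r_i$ being assigned an integer multiplicity $m_i\ge 2$; this is written $\mathcal R=\{r_1(m_1),\dots,r_\ell(m_\ell)\}$. For $w\in\mathcal L_n$ the multiplicity is $m(w)=\prod_{i=1}^{\ell}m_i^{n(w;r_i)}$, where $n(w;r_i)$ is the number of occurrences of $r_i$ as a subword of $w$. $\Lambda_n$ is the multiset in which each $w\in\mathcal L_n$ appears $m(w)$ times, so $|\Lambda_n|=\sum_{w\in\mathcal L_n}m(w)$, and $\Lambda^p=\bigcup_{n\ge p}\Lambda_n$. For words $X=x_1\dots x_k$, $Y=y_1\dots y_k$ with $k\ge2$, $X*Y$ is defined only if $x_2\dots x_k=y_1\dots y_{k-1}$, and then $X*Y=x_1\dots x_ky_k$; if $k=1$, $X*Y=x_1y_1$. For a non-negative integer matrix $A$ indexed by $\mathcal L_{p-1}$,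 $\mathcal G_A$ is the directed multigraph with vertex set $\mathcal L_{p-1}$ and $A_{XY}$ distinct edges from $X$ to $Y$; the edge shift $\Sigma_A$ is the set of all one-sided infinite paths of edges in $\mathcal G_A$, its language $\mathcal L(\Sigma_A)$ is the set of finite words occurring in it, and $h_{\mathrm{top}}(\Sigma_A)=\lim_{n\to\infty}\frac1n\ln(\text{number of words of length }n\text{ in }\mathcal L(\Sigma_A))$. "$\mathcal L(\Sigma_A)\subseteq\Lambda^p$" is inclusion up to relabelling of symbols via $p$-blocks: $A_{XY}=0$ unless $X*Y$ is defined and belongs to $\mathcal L_p$, and for every $n\ge p$ and every $w=x_1\dots x_n\in\mathcal L_n$, the number of paths of edges in $\mathcal G_A$ with vertices $X_1,\dots,X_{n-p+2}$ (in this order), where $X_i=x_i\dots x_{i+p-2}$, is at most $m(w)$. *)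

theory Defs
  imports Complex_Main "HOL-Library.Sublist" "HOL-Library.Multiset"
begin

text \<open>
  Words are lists, one-sided sequences are functions on \<^typ>\<open>nat\<close>, and the finite symbol set
  is a type of class \<^class>\<open>finite\<close>.  Contiguous subwords of words are
  \<^const>\<open>sublist\<close>s.
\<close>

definition occurs_in :: "'a list \<Rightarrow> (nat \<Rightarrow> 'a) \<Rightarrow> bool" where
  "occurs_in w x \<longleftrightarrow> (\<exists>i. w = map x [i..<i + length w])"

definition language :: "(nat \<Rightarrow> 'a) set \<Rightarrow> 'a list set" where
  "language X = {w. \<exists>x\<in>X. occurs_in w x}"

definition language_of_length :: "(nat \<Rightarrow> 'a) set \<Rightarrow> nat \<Rightarrow> 'a list set" where
  "language_of_length X n = {w \<in> language X. length w = n}"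

definition irreducible_shift :: "(nat \<Rightarrow> 'a) set \<Rightarrow> bool" where
  "irreducible_shift X \<longleftrightarrow>
     (\<forall>u\<in>language X. \<forall>v\<in>language X. \<exists>w. u @ w @ v \<in> language X)"

text \<open>
  For empty \<open>X\<close> the convention \<open>ln 0 = 0\<close> makes the entropy below \<open>0\<close>; and \<^const>\<open>lim\<close> is only
  meaningful if the sequence converges.
\<close>

definition entropy_seq :: "(nat \<Rightarrow> 'a) set \<Rightarrow> nat \<Rightarrow> real" where
  "entropy_seq X n = ln (real (card (language_of_length X n))) / real n"

definition h_top :: "(nat \<Rightarrow> 'a) set \<Rightarrow> real" where
  "h_top X = lim (entropy_seq X)"


definition reduced :: "'a list set \<Rightarrow> bool" where
  "reduced C \<longleftrightarrow> (\<forall>u\<in>C. \<forall>v\<in>C. u \<noteq> v \<longrightarrow> \<not> sublist u v)"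

definition forbidden_shift :: "'a list set \<Rightarrow> (nat \<Rightarrow> 'a) set" where
  "forbidden_shift F = {x. \<forall>f\<in>F. \<not> occurs_in f x}"

abbreviation allowed_words :: "'a list set \<Rightarrow> nat \<Rightarrow> 'a list set" where
  "allowed_words F n \<equiv> language_of_length (forbidden_shift F) n"


definition occurrences :: "'a list \<Rightarrow> 'a list \<Rightarrow> nat" where
  "occurrences w r = card {i. i + length r \<le> length w \<and> take (length r) (drop i w) = r}"

text \<open>
  A collection of repeated words is given by the set \<open>R\<close> of its words together with the
  assignment \<open>m\<close> of multiplicities; only the values of \<open>m\<close> on \<open>R\<close> matter.
\<close>

definition repeated_words :: "'a list set \<Rightarrow> 'a list set \<Rightarrow> ('a list \<Rightarrow> nat) \<Rightarrow> bool" where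
  "repeated_words F R m \<longleftrightarrow>
     finite R \<and> reduced R \<and> R \<subseteq> language (forbidden_shift F) \<and> (\<forall>r\<in>R. m r \<ge> 2)"

definition word_mult :: "'a list set \<Rightarrow> ('a list \<Rightarrow> nat) \<Rightarrow> 'a list \<Rightarrow> nat" where
  "word_mult R m w = (\<Prod>r\<in>R. m r ^ occurrences w r)"

definition Lambda ::
  "'a list set \<Rightarrow> 'a list set \<Rightarrow> ('a list \<Rightarrow> nat) \<Rightarrow> nat \<Rightarrow> 'a list multiset" where
  "Lambda F R m n = (\<Sum>w\<in>allowed_words F n. replicate_mset (word_mult R m w) w)"


text \<open>
  The partial operation \<open>X * Y\<close> on nonempty words of equal length \<open>k\<close>.  For \<open>k = 1\<close> both
  \<open>tl X\<close> and \<open>butlast Y\<close> are empty, so the product is always defined.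
\<close>

definition word_star :: "'a list \<Rightarrow> 'a list \<Rightarrow> 'a list option" where
  "word_star X Y =
     (if X \<noteq> [] \<and> length X = length Y \<and> tl X = butlast Y then Some (X @ [last Y]) else None)"

text \<open>
  A matrix indexed by a set \<open>V\<close> is a function of two arguments, of which only the values on
  \<open>V \<times> V\<close> are used.  The edges from \<open>X\<close> to \<open>Y\<close> are the triples \<open>(X, k, Y)\<close> with \<open>k < A X Y\<close>.
\<close>

definition graph_edges :: "'v set \<Rightarrow> ('v \<Rightarrow> 'v \<Rightarrow> nat) \<Rightarrow> ('v \<times> nat \<times> 'v) set" where
  "graph_edges V A = {(X, k, Y). X \<in> V \<and> Y \<in> V \<and> k < A X Y}"

definition edge_source :: "'v \<times> nat \<times> 'v \<Rightarrow> 'v" where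
  "edge_source e = fst e"

definition edge_target :: "'v \<times> nat \<times> 'v \<Rightarrow> 'v" where
  "edge_target e = snd (snd e)"

definition edge_shift :: "'v set \<Rightarrow> ('v \<Rightarrow> 'v \<Rightarrow> nat) \<Rightarrow> (nat \<Rightarrow> 'v \<times> nat \<times> 'v) set" where
  "edge_shift V A =
     {e. \<forall>i. e i \<in> graph_edges V A \<and> edge_target (e i) = edge_source (e (Suc i))}"

text \<open>The edge paths visiting exactly the vertices of the nonempty list \<open>Xs\<close>, in this order.\<close>

definition edge_paths_along ::
  "'v set \<Rightarrow> ('v \<Rightarrow> 'v \<Rightarrow> nat) \<Rightarrow> 'v list \<Rightarrow> ('v \<times> nat \<times> 'v) list set" where
  "edge_paths_along V A Xs =
     {es. Suc (length es) = length Xs \<and>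
          (\<forall>i<length es. es ! i \<in> graph_edges V A \<and>
             edge_source (es ! i) = Xs ! i \<and> edge_target (es ! i) = Xs ! Suc i)}"

definition blocks :: "nat \<Rightarrow> 'a list \<Rightarrow> 'a list list" where
  "blocks q w = map (\<lambda>i. take q (drop i w)) [0..<length w - q + 1]"

text \<open>
  Inclusion of the language of the edge shift of \<open>A\<close> in \<open>\<Lambda>\<^sup>p\<close>, up to relabelling of symbols via
  \<open>p\<close>-blocks: an edge from \<open>X\<close> to \<open>Y\<close> stands for a copy of the allowed word \<open>X * Y\<close> of length
  \<open>p\<close>, and each \<open>w\<close> is represented by at most as many edge paths as it has copies in \<open>\<Lambda>\<^sup>p\<close>.
\<close>

definition language_within_Lambda ::
  "'a list set \<Rightarrow> 'a list set \<Rightarrow> ('a list \<Rightarrow> nat) \<Rightarrow> nat \<Rightarrow>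
   ('a list \<Rightarrow> 'a list \<Rightarrow> nat) \<Rightarrow> bool" where
  "language_within_Lambda F R m p A \<longleftrightarrow>
     (\<forall>X\<in>allowed_words F (p - 1). \<forall>Y\<in>allowed_words F (p - 1).
        A X Y \<noteq> 0 \<longrightarrow> (\<exists>w\<in>allowed_words F p. word_star X Y = Some w)) \<and>
     (\<forall>n\<ge>p. \<forall>w\<in>allowed_words F n.
        card (edge_paths_along (allowed_words F (p - 1)) A (blocks (p - 1) w)) \<le> word_mult R m w)"

end

theory Submission
  imports Defs "HOL-Real_Asymp.Real_Asymp"
begin

text \<open>
  Put \<open>q = p - 1\<close> and let \<open>A X Y\<close> be the product of the multiplicities of the repeated words that are
  suffixes of \<open>X * Y\<close>.  Appending a symbol to a word multiplies its multiplicity by exactly this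
  factor, so the edge paths along \<open>w\<close> number \<open>m(w)\<close> divided by the multiplicity of the first \<open>q\<close>
  symbols of \<open>w\<close>.  Every vertex path is a path of blocks of an allowed word because forbidden words
  have length at most \<open>p\<close>; hence the numbers of words of the edge shift and the sizes of \<open>\<Lambda>\<close>
  agree up to a bounded factor and an index shift by \<open>q\<close>.  For positivity, extend a repeated word to
  an allowed word \<open>u\<close> of length at least \<open>p\<close> and take an allowed \<open>u w u\<close>: the periodic sequence
  \<open>u w u w \<dots>\<close> is allowed and contains the repeated word once per period.
\<close>

section \<open>Subadditive sequences\<close>

text \<open>The limit is the infimum \<open>L\<close> of the quotients. Division with remainder by a
  \<open>k\<close> whose quotient is within \<epsilon>/2 of \<open>L\<close> bounds
  \<open>a n\<close> by \<open>n\<close> times that quotient plus a constant.\<close>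

lemma fekete:
  fixes a :: "nat \<Rightarrow> real"
  assumes nonneg: "\<And>n. 0 \<le> a n" and subadd: "\<And>i j. a (i + j) \<le> a i + a j"
  shows "convergent (\<lambda>n. a n / real n)"
proof -
  define L where "L = (INF n\<in>{1..}. a n / real n)"
  have bdd: "bdd_below ((\<lambda>n. a n / real n) ` {1..})"
    using nonneg by (intro bdd_belowI2[where m = 0]) auto
  \<comment> \<open>The case \<open>j = 0\<close> is excluded because \<open>a 0\<close> need not
    vanish; accordingly \<open>ub\<close> below asks for \<open>n \<ge> k\<close>.\<close>
  have mult: "a (j * k) \<le> real j * a k" if "j \<ge> 1" for j k
    using that
  proof (induction j rule: dec_induct)
    case (step j)
    then show ?case using subadd[of k "j * k"] by (simp add: algebra_simps)
  qed simp
  have "(\<lambda>n. a n / real n) \<longlonglongrightarrow> L"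
  proof (rule LIMSEQ_I)
    fix \<epsilon> :: real assume "\<epsilon> > 0"
    then obtain k where k: "k \<ge> 1" "a k / real k < L + \<epsilon> / 2"
      using cINF_less_iff[OF _ bdd, of "L + \<epsilon> / 2"] unfolding L_def by auto
    \<comment> \<open>\<open>C\<close> bounds the contribution of every possible remainder modulo
      \<open>k\<close>; after division by \<open>n\<close> it becomes negligible.\<close>
    define C where "C = Max (a ` {..<k})"
    have C: "a r \<le> C" if "r < k" for r
      using that unfolding C_def by auto
    have "C \<ge> 0" using C[of 0] nonneg[of 0] k by simp
    have ub: "a n \<le> real n * (a k / real k) + C" if "n \<ge> k" for n
    proof -
      have "a n = a (n div k * k + n mod k)" by simp
      also have "\<dots> \<le> a (n div k * k) + a (n mod k)" by (rule subadd)
      also have "\<dots> \<le> real (n div k) * a k + C"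
        using mult[of "n div k" k] C[of "n mod k"] that k by (simp add: div_greater_zero_iff Suc_leI)
      also have "real (n div k) * a k \<le> real n / real k * a k"
        by (intro mult_right_mono of_nat_div_le_of_nat nonneg)
      finally show ?thesis by simp
    qed
    obtain N :: nat where N: "real N > 2 * C / \<epsilon>" using reals_Archimedean2 by blast
    show "\<exists>no. \<forall>n\<ge>no. norm (a n / real n - L) < \<epsilon>"
    proof (intro exI allI impI)
      fix n assume n: "n \<ge> max N k"
      then have n1: "n \<ge> 1" "n \<ge> k" using k by auto
      have "L \<le> a n / real n" unfolding L_def using n1 by (intro cINF_lower bdd) auto
      moreover have "a n / real n < L + \<epsilon>"
      proof -
        have "a n / real n \<le> a k / real k + C / real n"
          using ub[OF n1(2)] n1(1) by (simp add: field_simps)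
        moreover have "2 * C / \<epsilon> < real n" using N n by linarith
        then have "C / real n < \<epsilon> / 2" using n1(1) \<open>\<epsilon> > 0\<close> by (simp add: field_simps)
        ultimately show ?thesis using k by linarith
      qed
      ultimately show "norm (a n / real n - L) < \<epsilon>" by simp
    qed
  qed
  then show ?thesis by (rule convergentI)
qed

section \<open>Words of shift-invariant sets and convergence of the entropy\<close>

definition shift_invariant :: "(nat \<Rightarrow> 'a) set \<Rightarrow> bool" where
  "shift_invariant X \<longleftrightarrow> (\<forall>x\<in>X. \<forall>i. (\<lambda>j. x (i + j)) \<in> X)"

lemma map_upt_shift: "map (\<lambda>j. x (i + j)) [k..<k + n] = map x [i + k..<i + k + n]"
  by (rule nth_equalityI) (auto simp: algebra_simps)

lemma factor_in_language: "x \<in> X \<Longrightarrow> map x [i..<i + n] \<in> language X"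
  unfolding language_def occurs_in_def by auto

lemma prefix_in_language: "x \<in> X \<Longrightarrow> map x [0..<n] \<in> language X"
  using factor_in_language[of x X 0 n] by simp

text \<open>A word at position \<open>i\<close> of \<open>x\<close> is a prefix of the sequence
  shifted by \<open>i\<close>. Later counts thus need to treat only prefixes.\<close>

lemma language_of_length_prefixes:
  assumes "shift_invariant X"
  shows "language_of_length X n = (\<lambda>x. map x [0..<n]) ` X"
proof (intro equalityI subsetI)
  fix w assume "w \<in> language_of_length X n"
  then obtain x i where "x \<in> X" "w = map x [i..<i + n]"
    unfolding language_of_length_def language_def occurs_in_def by auto
  moreover from this have "w = map (\<lambda>j. x (i + j)) [0..<n]"
    using map_upt_shift[of x i 0 n] by simp
  ultimately show "w \<in> (\<lambda>x. map x [0..<n]) ` X"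
    using assms unfolding shift_invariant_def by blast
qed (auto simp: language_of_length_def prefix_in_language)

text \<open>Cutting a word after \<open>i\<close> symbols loses no information, and both pieces
  occur in the same sequence.\<close>

lemma language_of_length_add_le:
  assumes fin: "\<And>n. finite (language_of_length X n)"
  shows "card (language_of_length X (i + j))
    \<le> card (language_of_length X i) * card (language_of_length X j)"
proof -
  let ?f = "\<lambda>w. (take i w, drop i w)"
  have "inj_on ?f (language_of_length X (i + j))"
    by (rule inj_onI) (metis append_take_drop_id prod.inject)
  moreover have "?f ` language_of_length X (i + j)
    \<subseteq> language_of_length X i \<times> language_of_length X j"
  proof
    fix z assume "z \<in> ?f ` language_of_length X (i + j)"
    then obtain x k where x: "x \<in> X" "z = ?f (map x [k..<k + (i + j)])"
      unfolding language_of_length_def language_def occurs_in_def by auto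
    then have "z = (map x [k..<k + i], map x [k + i..<k + i + j])"
      by (simp add: take_map drop_map add.assoc)
    then show "z \<in> language_of_length X i \<times> language_of_length X j"
      using x(1) by (simp add: language_of_length_def factor_in_language)
  qed
  ultimately show ?thesis
    unfolding card_cartesian_product[symmetric]
    by (rule card_inj_on_le[OF _ _ finite_cartesian_product[OF fin fin]])
qed

text \<open>Logarithms turn submultiplicative counts into a subadditive sequence. A point of
  \<open>X\<close> makes every count at least 1, so the logarithms are nonnegative.\<close>

lemma entropy_seq_convergent:
  assumes fin: "\<And>n. finite (language_of_length X n)" and "X \<noteq> {}"
  shows "convergent (entropy_seq X)"
proof -
  obtain x where "x \<in> X" using assms by blast
  then have "map x [0..<n] \<in> language_of_length X n" for n
    by (simp add: language_of_length_def prefix_in_language)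
  then have pos: "card (language_of_length X n) > 0" for n
    using fin card_gt_0_iff by blast
  have "ln (real (card (language_of_length X (i + j))))
      \<le> ln (real (card (language_of_length X i))) + ln (real (card (language_of_length X j)))" for i j
  proof -
    have "ln (real (card (language_of_length X (i + j))))
      \<le> ln (real (card (language_of_length X i)) * real (card (language_of_length X j)))"
    proof (rule ln_mono)
      show "real (card (language_of_length X (i + j)))
        \<le> real (card (language_of_length X i)) * real (card (language_of_length X j))"
        using language_of_length_add_le[OF fin, of i j] by (metis of_nat_le_iff of_nat_mult)
    qed (use pos in simp)
    also have "\<dots> = ln (real (card (language_of_length X i))) + ln (real (card (language_of_length X j)))"
      using pos[of i] pos[of j] by (intro ln_mult_pos) auto
    finally show ?thesis .
  qed
  moreover have "0 \<le> ln (real (card (language_of_length X n)))" for n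
    using pos[of n] by simp
  ultimately show ?thesis unfolding entropy_seq_def by (intro fekete)
qed

section \<open>Forbidden shifts as a local condition\<close>

lemma shift_invariant_forbidden_shift: "shift_invariant (forbidden_shift F)"
  unfolding shift_invariant_def forbidden_shift_def occurs_in_def
  by (auto simp: map_upt_shift)

lemma shift_invariant_edge_shift: "shift_invariant (edge_shift V A)"
  unfolding shift_invariant_def edge_shift_def by auto

lemma finite_language_of_length: "finite (language_of_length X n :: 'a::finite list set)"
  using finite_lists_length_eq[of UNIV n] unfolding language_of_length_def
  by (rule finite_subset[rotated]) auto

text \<open>A forbidden word in \<open>x\<close> would fit into a window of length \<open>p\<close>,
  and that window also occurs in a point of the shift. The criterion serves both for sequences read
  off edge paths and for periodic sequences.\<close>

lemma forbidden_shiftI: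
  assumes "\<And>f. f \<in> F \<Longrightarrow> length f \<le> p"
    and "\<And>i. map x [i..<i + p] \<in> language (forbidden_shift F)"
  shows "x \<in> forbidden_shift F"
  unfolding forbidden_shift_def
proof (intro CollectI ballI notI)
  fix f assume f: "f \<in> F" "occurs_in f x"
  then obtain i where i: "f = map x [i..<i + length f]" unfolding occurs_in_def by blast
  obtain y k where y: "y \<in> forbidden_shift F" "map x [i..<i + p] = map y [k..<k + p]"
    using assms(2)[of i] unfolding language_def occurs_in_def by auto
  have "take (length f) (map x [i..<i + p]) = f"
    using i assms(1)[OF f(1)] by (simp add: take_map)
  then have "f = map y [k..<k + length f]"
    using assms(1)[OF f(1)] unfolding y(2) by (simp add: take_map)
  then show False using y(1) f(1) unfolding forbidden_shift_def occurs_in_def by auto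
qed

section \<open>Multiplicities when a symbol is appended\<close>

text \<open>Occurrences in the longer word either lie inside \<open>v\<close> (the set
  \<open>?S\<close>) or end at \<open>c\<close> (the set \<open>?T\<close>); the latter have a start
  fixed by the length of \<open>r\<close>, so there is at most one.\<close>

lemma occurrences_snoc:
  "occurrences (v @ [c]) r = occurrences v r + (if suffix r (v @ [c]) then 1 else 0)"
proof -
  let ?S = "{i. i + length r \<le> length v \<and> take (length r) (drop i v) = r}"
  let ?T = "{i. i + length r = Suc (length v) \<and> take (length r) (drop i (v @ [c])) = r}"
  have T: "?T = (if suffix r (v @ [c]) then {Suc (length v) - length r} else {})"
  proof (cases "suffix r (v @ [c])")
    case True
    then obtain u where u: "v @ [c] = u @ r" by (auto simp: suffix_def)
    then have "Suc (length v) = length u + length r"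
      by (metis length_append length_append_singleton)
    then show ?thesis using u True by auto
  next
    case False
    have "suffix r (v @ [c])"
      if "i + length r = Suc (length v)" "take (length r) (drop i (v @ [c])) = r" for i
    proof -
      have "drop i (v @ [c]) = r" using that by (metis add_diff_cancel_left' length_append_singleton length_drop order_refl take_all)
      then show ?thesis by (metis suffix_drop)
    qed
    then show ?thesis using False by auto
  qed
  have "{i. i + length r \<le> length (v @ [c]) \<and> take (length r) (drop i (v @ [c])) = r} = ?S \<union> ?T"
    by (auto simp: le_Suc_eq)
  moreover have "?S \<inter> ?T = {}" by auto
  moreover have "finite ?S" by (rule finite_subset[of _ "{..length v}"]) auto
  moreover have "finite ?T" unfolding T by simp
  ultimately have "occurrences (v @ [c]) r = card ?S + card ?T"
    unfolding occurrences_def by (simp add: card_Un_disjoint)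
  then show ?thesis unfolding T by (simp add: occurrences_def)
qed

text \<open>This is the factor contributed by the last symbol of \<open>w\<close>. For reduced
  \<open>R\<close> at most one word of \<open>R\<close> is a suffix of \<open>w\<close>, so at most
  one factor is nontrivial.\<close>

definition suffix_mult :: "'a list set \<Rightarrow> ('a list \<Rightarrow> nat) \<Rightarrow> 'a list \<Rightarrow> nat" where
  "suffix_mult R m w = (\<Prod>r\<in>R. if suffix r w then m r else 1)"

lemma word_mult_snoc: "word_mult R m (v @ [c]) = word_mult R m v * suffix_mult R m (v @ [c])"
  unfolding word_mult_def suffix_mult_def occurrences_snoc prod.distrib[symmetric]
  by (rule prod.cong) auto

text \<open>The factor depends only on a final window at least as long as every repeated word; hence
  an edge, which sees only \<open>p\<close> symbols, can record it.\<close>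

lemma suffix_mult_append:
  assumes "\<And>r. r \<in> R \<Longrightarrow> length r \<le> length w"
  shows "suffix_mult R m (u @ w) = suffix_mult R m w"
  unfolding suffix_mult_def
proof (rule prod.cong)
  fix r assume "r \<in> R"
  then have "suffix r (u @ w) \<longleftrightarrow> suffix r w"
    using assms suffix_length_suffix[of r "u @ w" w] suffix_appendI by (metis suffixI)
  then show "(if suffix r (u @ w) then m r else 1) = (if suffix r w then m r else 1)" by simp
qed simp

lemma suffix_mult_pos: "(\<And>r. r \<in> R \<Longrightarrow> m r > 0) \<Longrightarrow> suffix_mult R m w > 0"
  unfolding suffix_mult_def by (intro prod_pos) auto

lemma word_mult_pos: "(\<And>r. r \<in> R \<Longrightarrow> m r > 0) \<Longrightarrow> word_mult R m w > 0"
  unfolding word_mult_def by (intro prod_pos) auto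

lemma size_Lambda: "size (Lambda F R m n) = (\<Sum>w\<in>allowed_words F n. word_mult R m w)"
  unfolding Lambda_def by simp

section \<open>The block matrix and the number of edge paths along a word\<close>

text \<open>For empty \<open>R\<close> this is the 0-1 matrix of the higher block presentation of
  the forbidden shift; repeated words add parallel edges.\<close>

definition block_matrix ::
  "'a list set \<Rightarrow> 'a list set \<Rightarrow> ('a list \<Rightarrow> nat) \<Rightarrow> nat \<Rightarrow> 'a list \<Rightarrow> 'a list \<Rightarrow> nat" where
  "block_matrix F R m p X Y =
     (case word_star X Y of
        None \<Rightarrow> 0
      | Some w \<Rightarrow> if w \<in> allowed_words F p then suffix_mult R m w else 0)"

lemma edge_paths_along_snoc_iff:
  "es @ [e] \<in> edge_paths_along V A (Xs @ [X, Y]) \<longleftrightarrow>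
     es \<in> edge_paths_along V A (Xs @ [X]) \<and>
     e \<in> graph_edges V A \<and> edge_source e = X \<and> edge_target e = Y"
proof (cases "length es = length Xs")
  case True
  have "(Xs @ [X, Y]) ! Suc i = (Xs @ [X]) ! Suc i" "(Xs @ [X, Y]) ! i = (Xs @ [X]) ! i"
    if "i < length Xs" for i
    using that by (cases "Suc i = length Xs"; simp add: nth_append)+
  moreover have "(Xs @ [X, Y]) ! length Xs = X" "(Xs @ [X, Y]) ! Suc (length Xs) = Y"
    by (simp_all add: nth_append)
  ultimately show ?thesis
    using True unfolding edge_paths_along_def
    by (auto simp: All_less_Suc nth_append)
qed (simp add: edge_paths_along_def)

text \<open>A path with one more edge is a shorter path together with the index \<open>k\<close> of
  the chosen parallel edge, so path counts are products of matrix entries.\<close>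

lemma card_edge_paths_along_snoc:
  assumes "X \<in> V" "Y \<in> V"
  shows "card (edge_paths_along V A (Xs @ [X, Y])) = card (edge_paths_along V A (Xs @ [X])) * A X Y"
proof -
  let ?f = "\<lambda>(es, k). es @ [(X, k, Y)]"
  have "edge_paths_along V A (Xs @ [X, Y]) = ?f ` (edge_paths_along V A (Xs @ [X]) \<times> {..<A X Y})"
  proof (intro equalityI subsetI)
    fix es assume es: "es \<in> edge_paths_along V A (Xs @ [X, Y])"
    then have "es \<noteq> []" by (auto simp: edge_paths_along_def)
    then obtain es' e where e: "es = es' @ [e]" by (meson rev_exhaust)
    obtain k where k: "e = (X, k, Y)" "k < A X Y"
      using es unfolding e edge_paths_along_snoc_iff
      by (cases e) (auto simp: graph_edges_def edge_source_def edge_target_def)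
    show "es \<in> ?f ` (edge_paths_along V A (Xs @ [X]) \<times> {..<A X Y})"
      using es k unfolding e edge_paths_along_snoc_iff by (intro image_eqI[of _ _ "(es', k)"]) auto
  next
    fix es assume "es \<in> ?f ` (edge_paths_along V A (Xs @ [X]) \<times> {..<A X Y})"
    then show "es \<in> edge_paths_along V A (Xs @ [X, Y])"
      using assms
      by (auto simp: edge_paths_along_snoc_iff graph_edges_def edge_source_def edge_target_def)
  qed
  moreover have "inj_on ?f (edge_paths_along V A (Xs @ [X]) \<times> {..<A X Y})"
    by (auto intro: inj_onI)
  ultimately show ?thesis by (simp add: card_image card_cartesian_product)
qed

text \<open>A word of length \<open>n + q\<close> has \<open>n + 1\<close> blocks of length
  \<open>q\<close>, hence its paths have \<open>n\<close> edges. This is the source of the index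
  shift by \<open>q\<close>.\<close>

lemma blocks_prefix:
  "blocks q (map x [0..<n + q]) = map (\<lambda>j. map x [j..<j + q]) [0..<Suc n]"
  unfolding blocks_def
proof (rule nth_equalityI)
  fix i assume "i < length (map (\<lambda>i. take q (drop i (map x [0..<n + q]))) [0..<length (map x [0..<n + q]) - q + 1])"
  then have "i \<le> n" by simp
  then show "map (\<lambda>i. take q (drop i (map x [0..<n + q]))) [0..<length (map x [0..<n + q]) - q + 1] ! i
    = map (\<lambda>j. map x [j..<j + q]) [0..<Suc n] ! i"
    by (simp add: take_map drop_map del: upt_Suc)
qed simp

lemma word_star_factors:
  assumes "q > 0"
  shows "word_star (map x [i..<i + q]) (map x [Suc i..<Suc i + q]) = Some (map x [i..<Suc (i + q)])"
proof -
  have "tl (map x [i..<i + q]) = butlast (map x [Suc i..<Suc i + q])"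
    using assms by (intro nth_equalityI) (auto simp: nth_tl nth_butlast)
  moreover have "last (map x [Suc i..<Suc i + q]) = x (i + q)"
    using assms by (simp add: last_map)
  ultimately show ?thesis using assms unfolding word_star_def by simp
qed

text \<open>By induction, each new edge multiplies both sides by the factor of the new symbol. The
  first \<open>q\<close> symbols precede all edges, so their multiplicity stays as a separate
  factor.\<close>

lemma card_edge_paths_along_blocks:
  assumes x: "x \<in> forbidden_shift F" and "q > 0"
    and R: "\<And>r. r \<in> R \<Longrightarrow> length r \<le> Suc q"
  shows "card (edge_paths_along (allowed_words F q) (block_matrix F R m (Suc q))
           (blocks q (map x [0..<n + q]))) * word_mult R m (map x [0..<q])
         = word_mult R m (map x [0..<n + q])"
proof (induction n)
  case 0
  have "edge_paths_along V A [X] = {[]}" for V A and X :: "'a list"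
    unfolding edge_paths_along_def by auto
  then show ?case using blocks_prefix[of q x 0] by simp
next
  case (Suc n)
  let ?X = "\<lambda>j. map x [j..<j + q]"
  let ?A = "block_matrix F R m (Suc q)" and ?V = "allowed_words F q"
  let ?c = "\<lambda>n. card (edge_paths_along ?V ?A (blocks q (map x [0..<n + q])))"
  have V: "?X j \<in> ?V" for j
    using factor_in_language[OF x] by (simp add: language_of_length_def)
  have "map x [n..<Suc (n + q)] \<in> allowed_words F (Suc q)"
    using factor_in_language[OF x, of n "Suc q"] by (simp add: language_of_length_def)
  then have A: "?A (?X n) (?X (Suc n)) = suffix_mult R m (map x [n..<Suc (n + q)])"
    unfolding block_matrix_def word_star_factors[OF \<open>q > 0\<close>] by simp
  \<comment> \<open>Restoring the symbols before the window turns the matrix entry into the factor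
    for the whole prefix.\<close>
  also have "\<dots> = suffix_mult R m (map x [0..<n] @ map x [n..<Suc (n + q)])"
    using R by (intro suffix_mult_append[symmetric]) simp
  also have "map x [0..<n] @ map x [n..<Suc (n + q)] = map x [0..<n + q] @ [x (n + q)]"
    using upt_add_eq_append[of 0 n q] by simp
  finally have A': "?A (?X n) (?X (Suc n)) = suffix_mult R m (map x [0..<n + q] @ [x (n + q)])" .
  have "?c (Suc n) = ?c n * ?A (?X n) (?X (Suc n))"
    using card_edge_paths_along_snoc[OF V[of n] V[of "Suc n"], of ?A "map ?X [0..<n]"]
    unfolding blocks_prefix by simp
  then have "?c (Suc n) * word_mult R m (map x [0..<q])
    = ?c n * word_mult R m (map x [0..<q]) * ?A (?X n) (?X (Suc n))"
    by simp
  also have "\<dots> = word_mult R m (map x [0..<n + q]) * ?A (?X n) (?X (Suc n))"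
    unfolding Suc.IH ..
  also have "\<dots> = word_mult R m (map x [0..<Suc n + q])"
    unfolding A' by (simp flip: word_mult_snoc)
  finally show ?case .
qed

section \<open>Finite and infinite edge paths\<close>

text \<open>After its last edge the path continues along the blocks of \<open>x\<close>, always by
  the parallel edge with index 0, which exists because multiplicities are positive.\<close>

lemma edge_path_extends:
  assumes x: "x \<in> forbidden_shift F" and "q > 0"
    and m: "\<And>r. r \<in> R \<Longrightarrow> m r > 0"
    and es: "es \<in> edge_paths_along (allowed_words F q) (block_matrix F R m (Suc q))
               (blocks q (map x [0..<n + q]))"
  shows "\<exists>e\<in>edge_shift (allowed_words F q) (block_matrix F R m (Suc q)). es = map e [0..<n]"
proof -
  let ?X = "\<lambda>j. map x [j..<j + q]"
  let ?A = "block_matrix F R m (Suc q)" and ?V = "allowed_words F q"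
  define e where "e j = (if j < n then es ! j else (?X j, 0, ?X (Suc j)))" for j
  have V: "?X j \<in> ?V" for j
    using factor_in_language[OF x] by (simp add: language_of_length_def)
  have "map x [j..<Suc (j + q)] \<in> allowed_words F (Suc q)" for j
    using factor_in_language[OF x, of j "Suc q"] by (simp add: language_of_length_def)
  then have A: "0 < ?A (?X j) (?X (Suc j))" for j
    unfolding block_matrix_def word_star_factors[OF \<open>q > 0\<close>] using suffix_mult_pos[of R m] m by simp
  have es': "length es = n"
    "\<And>j. j < n \<Longrightarrow> es ! j \<in> graph_edges ?V ?A \<and> edge_source (es ! j) = ?X j \<and> edge_target (es ! j) = ?X (Suc j)"
    using es unfolding edge_paths_along_def blocks_prefix by (auto simp del: upt_Suc)
  have "e j \<in> graph_edges ?V ?A \<and> edge_source (e j) = ?X j \<and> edge_target (e j) = ?X (Suc j)" for j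
    using es' V[of j] V[of "Suc j"] A[of j] unfolding e_def
    by (cases "j < n") (auto simp: graph_edges_def edge_source_def edge_target_def simp del: upt_Suc)
  then have "e \<in> edge_shift ?V ?A" unfolding edge_shift_def by auto
  moreover have "es = map e [0..<n]" using es' by (intro nth_equalityI) (auto simp: e_def)
  ultimately show ?thesis by blast
qed

text \<open>The sequence consists of the first symbols of the vertices. Consecutive vertices
  overlap, so these determine each vertex completely, and every window of length
  \<open>Suc q\<close> is the allowed word of an edge.\<close>

lemma edge_shift_sequence:
  assumes e: "e \<in> edge_shift (allowed_words F q) (block_matrix F R m (Suc q))" and "q > 0"
    and F: "\<And>f. f \<in> F \<Longrightarrow> length f \<le> Suc q"
  obtains x where "x \<in> forbidden_shift F" "\<And>j. edge_source (e j) = map x [j..<j + q]"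
proof -
  let ?A = "block_matrix F R m (Suc q)" and ?V = "allowed_words F q"
  define X where "X j = edge_source (e j)" for j
  define x where "x j = X j ! 0" for j
  have len: "length (X j) = q" for j
    using e unfolding edge_shift_def graph_edges_def X_def edge_source_def language_of_length_def
    by (auto simp: case_prod_beta)
  have "\<exists>w\<in>allowed_words F (Suc q). word_star (X j) (X (Suc j)) = Some w" for j
  proof -
    have "e j \<in> graph_edges ?V ?A" "edge_target (e j) = X (Suc j)"
      using e unfolding edge_shift_def X_def by auto
    then have "?A (X j) (X (Suc j)) \<noteq> 0"
      unfolding graph_edges_def X_def edge_source_def edge_target_def by auto
    then show ?thesis unfolding block_matrix_def by (auto split: option.splits if_splits)
  qed
  then obtain W where W: "\<And>j. word_star (X j) (X (Suc j)) = Some (W j)" "\<And>j. W j \<in> allowed_words F (Suc q)"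
    by metis
  have step: "X j ! Suc t = X (Suc j) ! t" if "Suc t < q" for j t
  proof -
    have "tl (X j) = butlast (X (Suc j))"
      using W(1)[of j] unfolding word_star_def by (auto split: if_splits)
    then have "tl (X j) ! t = butlast (X (Suc j)) ! t" by simp
    then show ?thesis using that len by (simp add: nth_tl nth_butlast)
  qed
  \<comment> \<open>Symbol \<open>Suc t\<close> of one vertex is symbol \<open>t\<close> of the
    next, so the induction must vary \<open>j\<close>.\<close>
  have "X j ! t = x (j + t)" if "t < q" for j t
    using that
  proof (induction t arbitrary: j)
    case (Suc t)
    then show ?case using step[of t j] Suc.IH[of "Suc j"] by simp
  qed (simp add: x_def)
  then have X: "X j = map x [j..<j + q]" for j
    using len by (intro nth_equalityI) auto
  have "map x [j..<j + Suc q] \<in> language (forbidden_shift F)" for j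
    using W[of j] unfolding X word_star_factors[OF \<open>q > 0\<close>] by (auto simp: language_of_length_def)
  then have "x \<in> forbidden_shift F" using F by (rule forbidden_shiftI[rotated])
  then show ?thesis using that X unfolding X_def by blast
qed

lemma language_edge_shift:
  assumes "q > 0"
    and F: "\<And>f. f \<in> F \<Longrightarrow> length f \<le> Suc q"
    and m: "\<And>r. r \<in> R \<Longrightarrow> m r > 0"
  defines "V \<equiv> allowed_words F q" and "A \<equiv> block_matrix F R m (Suc q)"
  shows "language_of_length (edge_shift V A) n
    = (\<Union>w\<in>allowed_words F (n + q). edge_paths_along V A (blocks q w))"
proof (intro equalityI subsetI)
  fix es assume "es \<in> language_of_length (edge_shift V A) n"
  then obtain e where e: "e \<in> edge_shift V A" "es = map e [0..<n]"
    unfolding language_of_length_prefixes[OF shift_invariant_edge_shift] by auto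
  obtain x where x: "x \<in> forbidden_shift F" "\<And>j. edge_source (e j) = map x [j..<j + q]"
    using edge_shift_sequence[OF e(1)[unfolded V_def A_def] assms(1) F] by blast
  have "edge_target (e j) = map x [Suc j..<Suc j + q]" for j
    using e(1) x(2)[of "Suc j"] unfolding edge_shift_def by auto
  then have "es \<in> edge_paths_along V A (blocks q (map x [0..<n + q]))"
    unfolding e(2) edge_paths_along_def blocks_prefix using e(1) x(2)
    by (auto simp: edge_shift_def nth_append simp del: upt_Suc)
  then show "es \<in> (\<Union>w\<in>allowed_words F (n + q). edge_paths_along V A (blocks q w))"
    using x(1) unfolding language_of_length_prefixes[OF shift_invariant_forbidden_shift] by blast
next
  fix es assume "es \<in> (\<Union>w\<in>allowed_words F (n + q). edge_paths_along V A (blocks q w))"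
  then obtain x where x: "x \<in> forbidden_shift F" "es \<in> edge_paths_along V A (blocks q (map x [0..<n + q]))"
    unfolding language_of_length_prefixes[OF shift_invariant_forbidden_shift] by auto
  obtain e where "e \<in> edge_shift V A" "es = map e [0..<n]"
    using edge_path_extends[OF x(1) assms(1) m x(2)[unfolded V_def A_def]] unfolding V_def A_def by blast
  then show "es \<in> language_of_length (edge_shift V A) n"
    unfolding language_of_length_prefixes[OF shift_invariant_edge_shift] by blast
qed

text \<open>A path without edges does not determine its vertex, hence \<open>n > 0\<close>.\<close>

lemma edge_paths_along_blocks_determine_word:
  assumes "n > 0" "q > 0"
    and es: "es \<in> edge_paths_along V A (blocks q (map x [0..<n + q]))"
      "es \<in> edge_paths_along V A (blocks q (map y [0..<n + q]))"
  shows "map x [0..<n + q] = map y [0..<n + q]"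
proof -
  have eq: "map x [j..<j + q] = map y [j..<j + q]" if j: "j \<le> n" for j
  proof (cases "j < n")
    case True
    then have "edge_source (es ! j) = map x [j..<j + q]" "edge_source (es ! j) = map y [j..<j + q]"
      using es unfolding edge_paths_along_def blocks_prefix by (auto simp del: upt_Suc)
    then show ?thesis by simp
  next
    \<comment> \<open>The last block is the source of no edge of the path; it is read as the target
      of the final edge.\<close>
    case False
    then obtain k where k: "n = Suc k" "j = Suc k" using j assms(1) by (cases n) auto
    then have "edge_target (es ! k) = map x [j..<j + q]" "edge_target (es ! k) = map y [j..<j + q]"
      using es unfolding edge_paths_along_def blocks_prefix k by (auto simp del: upt_Suc)
    then show ?thesis by simp
  qed
  show ?thesis
  proof (rule nth_equalityI)
    fix t assume "t < length (map x [0..<n + q])"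
    \<comment> \<open>Position \<open>t\<close> is the first symbol of block \<open>t\<close> if
      \<open>t < n\<close>, and otherwise lies in the last block, which starts at
      \<open>n\<close>.\<close>
    then have t: "min t n \<le> n" "t - min t n < q" "t = min t n + (t - min t n)"
      using assms(2) by auto
    then show "map x [0..<n + q] ! t = map y [0..<n + q] ! t"
      using arg_cong[OF eq[OF t(1)], of "\<lambda>w. w ! (t - min t n)"]
      by (auto simp: min_def split: if_splits)
  qed simp
qed

text \<open>
  The factor \<open>C\<close> absorbs the occurrences ending within the first \<open>q\<close> symbols, which no edge records.
\<close>

lemma card_language_edge_shift_bounds:
  fixes F R :: "'a::finite list set"
  assumes "q > 0"
    and F: "\<And>f. f \<in> F \<Longrightarrow> length f \<le> Suc q"
    and R: "\<And>r. r \<in> R \<Longrightarrow> length r \<le> Suc q"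
    and m: "\<And>r. r \<in> R \<Longrightarrow> m r > 0"
  defines "V \<equiv> allowed_words F q" and "A \<equiv> block_matrix F R m (Suc q)"
  defines "C \<equiv> (\<Sum>u\<in>allowed_words F q. word_mult R m u)"
  shows "finite (language_of_length (edge_shift V A) n)"
    and "w \<in> allowed_words F (n + q) \<Longrightarrow>
      card (edge_paths_along V A (blocks q w)) \<le> word_mult R m w"
    and "n > 0 \<Longrightarrow> card (language_of_length (edge_shift V A) n) \<le> size (Lambda F R m (n + q))"
    and "n > 0 \<Longrightarrow> size (Lambda F R m (n + q)) \<le> card (language_of_length (edge_shift V A) n) * C"
proof -
  let ?P = "\<lambda>w. edge_paths_along V A (blocks q w)"
  have P: "finite (?P w)" "card (?P w) \<le> word_mult R m w" "word_mult R m w \<le> card (?P w) * C"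
    if w: "w \<in> allowed_words F (n + q)" for w n
  proof -
    obtain x where x: "x \<in> forbidden_shift F" "w = map x [0..<n + q]"
      using w unfolding language_of_length_prefixes[OF shift_invariant_forbidden_shift] by blast
    let ?u = "map x [0..<q]"
    have eq: "card (?P w) * word_mult R m ?u = word_mult R m w"
      unfolding x(2) V_def A_def by (rule card_edge_paths_along_blocks[OF x(1) assms(1) R])
    have pos: "word_mult R m v > 0" for v using word_mult_pos[of R m] m by blast
    \<comment> \<open>Infinite sets have \<open>card\<close> 0, so a positive cardinality gives
      finiteness.\<close>
    have "0 < card (?P w) * word_mult R m ?u" unfolding eq by (rule pos)
    then show "finite (?P w)" by (intro card_ge_0_finite) simp
    have "card (?P w) * 1 \<le> card (?P w) * word_mult R m ?u"
      using pos[of ?u] by (intro mult_le_mono2) simp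
    then show "card (?P w) \<le> word_mult R m w" unfolding eq by simp
    have "?u \<in> allowed_words F q"
      unfolding language_of_length_prefixes[OF shift_invariant_forbidden_shift] using x(1) by blast
    then have "word_mult R m ?u \<le> C"
      unfolding C_def by (intro member_le_sum finite_language_of_length) auto
    then show "word_mult R m w \<le> card (?P w) * C" unfolding eq[symmetric] by (rule mult_le_mono2)
  qed
  have L: "language_of_length (edge_shift V A) n = (\<Union>w\<in>allowed_words F (n + q). ?P w)"
    unfolding V_def A_def using assms(1) F m by (rule language_edge_shift)
  show "finite (language_of_length (edge_shift V A) n)"
    unfolding L by (intro finite_UN_I finite_language_of_length P(1))
  show "card (?P w) \<le> word_mult R m w" if "w \<in> allowed_words F (n + q)" using P(2) that .
  assume "n > 0"
  have "?P w \<inter> ?P v = {}" if wv: "w \<in> allowed_words F (n + q)" "v \<in> allowed_words F (n + q)" "w \<noteq> v" for w v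
  proof -
    obtain x y where "w = map x [0..<n + q]" "v = map y [0..<n + q]"
      using wv unfolding language_of_length_prefixes[OF shift_invariant_forbidden_shift] by blast
    then show ?thesis
      using edge_paths_along_blocks_determine_word[OF \<open>n > 0\<close> \<open>q > 0\<close>, of _ V A x y] wv(3) by blast
  qed
  then have card: "card (language_of_length (edge_shift V A) n) = (\<Sum>w\<in>allowed_words F (n + q). card (?P w))"
    unfolding L by (intro card_UN_disjoint finite_language_of_length) (use P(1) in auto)
  show "card (language_of_length (edge_shift V A) n) \<le> size (Lambda F R m (n + q))"
    unfolding card size_Lambda by (intro sum_mono P(2))
  show "size (Lambda F R m (n + q)) \<le> card (language_of_length (edge_shift V A) n) * C"
    unfolding card size_Lambda sum_distrib_right by (intro sum_mono P(3))
qed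

section \<open>Periodic points and exponential growth\<close>

lemma periodic_occurrences:
  assumes irr: "irreducible_shift (forbidden_shift F)" and r: "r \<in> language (forbidden_shift F)"
    and "p > 0" and F: "\<And>f. f \<in> F \<Longrightarrow> length f \<le> p"
  obtains x N where "x \<in> forbidden_shift F" "N > 0" "\<And>k. map x [k * N..<k * N + length r] = r"
proof -
  obtain y i where y: "y \<in> forbidden_shift F" "r = map y [i..<i + length r]"
    using r unfolding language_def occurs_in_def by blast
  \<comment> \<open>The padding by \<open>p\<close> symbols ensures that a window of length
    \<open>p\<close> starting in the first period of \<open>u @ w @ u\<close> ends within the second
    copy of \<open>u\<close>.\<close>
  define u where "u = map y [i..<i + (length r + p)]"
  have u: "length u = length r + p" unfolding u_def by simp
  have ur: "u ! t = r ! t" if "t < length r" for t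
    using that arg_cong[OF y(2), of "\<lambda>w. w ! t"] unfolding u_def by simp
  have "u \<in> language (forbidden_shift F)" unfolding u_def by (rule factor_in_language[OF y(1)])
  then obtain w where "u @ w @ u \<in> language (forbidden_shift F)"
    using irr unfolding irreducible_shift_def by blast
  then obtain z j where z: "z \<in> forbidden_shift F" "u @ w @ u = map z [j..<j + length (u @ w @ u)]"
    unfolding language_def occurs_in_def by blast
  define N where "N = length (u @ w)"
  have N: "N > 0" "length u \<le> N" unfolding N_def using \<open>p > 0\<close> u by auto
  have z1: "z (j + t) = u ! t" if "t < length u" for t
    using that arg_cong[OF z(2), of "\<lambda>v. v ! t"] by (simp add: nth_append)
  have z2: "z (j + (N + t)) = u ! t" if "t < length u" for t
    using that arg_cong[OF z(2), of "\<lambda>v. v ! (N + t)"] unfolding N_def by (simp add: nth_append)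
  define x where "x t = z (j + t mod N)" for t
  \<comment> \<open>Where a window of \<open>x\<close> wraps around to the start of the period, the
    window of \<open>z\<close> runs on into the second copy of \<open>u\<close>; both read the same
    symbols.\<close>
  have "map x [i..<i + p] = map z [j + i mod N..<j + i mod N + p]" for i
  proof (rule nth_equalityI)
    fix t assume "t < length (map x [i..<i + p])"
    then have t: "t < p" by simp
    have "z (j + (i + t) mod N) = z (j + (i mod N + t))"
    proof (cases "i mod N + t < N")
      case True
      then have "(i + t) mod N = i mod N + t" by (metis mod_add_left_eq mod_less)
      then show ?thesis by simp
    next
      case False
      define s where "s = i mod N + t - N"
      have s: "i mod N + t = N + s" using False unfolding s_def by simp
      have "s < length u" using s t u mod_less_divisor[OF N(1), of i] by linarith
      moreover have "(i + t) mod N = s"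
        using \<open>s < length u\<close> N(2) s by (metis mod_add_left_eq mod_add_self1 mod_less order_less_le_trans)
      ultimately show ?thesis unfolding s using z1 z2 by simp
    qed
    then show "map x [i..<i + p] ! t = map z [j + i mod N..<j + i mod N + p] ! t"
      using t by (simp add: x_def add.assoc)
  qed simp
  then have "x \<in> forbidden_shift F"
    using factor_in_language[OF z(1)] by (intro forbidden_shiftI[OF F]) auto
  moreover have "map x [k * N..<k * N + length r] = r" for k
  proof (rule nth_equalityI)
    fix t assume "t < length (map x [k * N..<k * N + length r])"
    then have t: "t < length r" by simp
    then have "t < length u" using u by simp
    then show "map x [k * N..<k * N + length r] ! t = r ! t"
      using t ur N(2) z1 by (simp add: x_def)
  qed simp
  ultimately show ?thesis using that N(1) by blast
qed

text \<open>A single word suffices: a prefix of the periodic point contains \<open>r\<close> at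
  \<open>0, N, ..., (k - 1) * N\<close>, and each occurrence contributes a factor of at least
  2.\<close>

lemma size_Lambda_exponential:
  fixes F R :: "'a::finite list set"
  assumes irr: "irreducible_shift (forbidden_shift F)" and R: "repeated_words F R m" and "r \<in> R"
    and "p > 0" and F: "\<And>f. f \<in> F \<Longrightarrow> length f \<le> p"
  obtains N where "N > 0" "\<And>k. 2 ^ k \<le> size (Lambda F R m (k * N + length r))"
proof -
  have R': "r \<in> language (forbidden_shift F)" "finite R" "\<And>s. s \<in> R \<Longrightarrow> m s \<ge> 2"
    using R \<open>r \<in> R\<close> unfolding repeated_words_def by auto
  obtain x N where x: "x \<in> forbidden_shift F" "N > 0" "\<And>k. map x [k * N..<k * N + length r] = r"
    using periodic_occurrences[OF irr R'(1) \<open>p > 0\<close> F] by blast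
  have "2 ^ k \<le> size (Lambda F R m (k * N + length r))" for k
  proof -
    let ?w = "map x [0..<k * N + length r]"
    let ?O = "{i. i + length r \<le> length ?w \<and> take (length r) (drop i ?w) = r}"
    have "(\<lambda>i. i * N) ` {..<k} \<subseteq> ?O"
    proof
      fix j assume "j \<in> (\<lambda>i. i * N) ` {..<k}"
      then obtain i where i: "i < k" "j = i * N" by auto
      have "i * N \<le> k * N" using i(1) by simp
      then show "j \<in> ?O" using x(3)[of i] i(2) by (simp add: take_map drop_map)
    qed
    moreover have "finite ?O" by (rule finite_subset[of _ "{..length ?w}"]) auto
    ultimately have "card ((\<lambda>i. i * N) ` {..<k}) \<le> occurrences ?w r"
      unfolding occurrences_def by (intro card_mono)
    moreover have "inj_on (\<lambda>i. i * N) {..<k}" using x(2) by (intro inj_onI) simp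
    ultimately have "k \<le> occurrences ?w r" by (simp add: card_image)
    then have "2 ^ k \<le> (2::nat) ^ occurrences ?w r" by simp
    also have "\<dots> \<le> m r ^ occurrences ?w r" using R'(3)[OF \<open>r \<in> R\<close>] by (rule power_mono) simp
    also have "\<dots> \<le> word_mult R m ?w"
    proof -
      have "m s > 0" if "s \<in> R" for s using R'(3)[OF that] by simp
      \<comment> \<open>The other repeated words contribute a positive integer, so dropping them
        does not increase the product.\<close>
      then have "(\<Prod>s\<in>R - {r}. m s ^ occurrences ?w s) > 0" by (intro prod_pos) auto
      then show ?thesis
        unfolding word_mult_def using prod.remove[OF R'(2) \<open>r \<in> R\<close>, of "\<lambda>s. m s ^ occurrences ?w s"]
        by simp
    qed
    also have "\<dots> \<le> (\<Sum>w\<in>allowed_words F (k * N + length r). word_mult R m w)"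
      using x(1) by (intro member_le_sum finite_language_of_length)
        (auto simp: language_of_length_prefixes[OF shift_invariant_forbidden_shift])
    finally show ?thesis unfolding size_Lambda .
  qed
  then show ?thesis using that x(2) by blast
qed

section \<open>Entropy as the growth rate of the multiset sizes\<close>

text \<open>A squeeze: the constant contributes \<open>ln C / (n + q)\<close>, which tends to 0, and
  replacing the denominator \<open>n\<close> by \<open>n + q\<close> costs a factor tending to
  1.\<close>

lemma entropy_seq_comparison:
  fixes l :: "nat \<Rightarrow> nat"
  assumes conv: "convergent (entropy_seq X)"
    and pos: "\<And>n. card (language_of_length X n) > 0"
    and le: "\<And>n. n > 0 \<Longrightarrow> card (language_of_length X n) \<le> l (n + q)"
    and ge: "\<And>n. n > 0 \<Longrightarrow> l (n + q) \<le> card (language_of_length X n) * C"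
  shows "(\<lambda>n. ln (real (l n)) / real n) \<longlonglongrightarrow> h_top X"
proof -
  let ?c = "\<lambda>n. real (card (language_of_length X n))"
  have "0 < card (language_of_length X 1)" by (rule pos)
  \<comment> \<open>With \<open>C = 0\<close> the upper bound would force
    \<open>l (1 + q) = 0\<close>, against the lower bound.\<close>
  then have "C > 0" using le[of 1] ge[of 1] by (cases C) auto
  have "entropy_seq X \<longlonglongrightarrow> h_top X"
    using conv unfolding h_top_def by (simp add: convergent_LIMSEQ_iff)
  moreover have "(\<lambda>n. real n / real (n + q)) \<longlonglongrightarrow> 1" by real_asymp
  ultimately have "(\<lambda>n. entropy_seq X n * (real n / real (n + q))) \<longlonglongrightarrow> h_top X"
    using tendsto_mult by fastforce
  moreover have "\<forall>\<^sub>F n in sequentially.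
      entropy_seq X n * (real n / real (n + q)) = ln (?c n) / real (n + q)"
    using eventually_gt_at_top[of 0] by eventually_elim (simp add: entropy_seq_def)
  ultimately have lower: "(\<lambda>n. ln (?c n) / real (n + q)) \<longlonglongrightarrow> h_top X"
    by (rule Lim_transform_eventually)
  have "(\<lambda>n. ln (real C) / real (n + q)) \<longlonglongrightarrow> 0" by real_asymp
  from tendsto_add[OF lower this]
  have upper: "(\<lambda>n. ln (?c n) / real (n + q) + ln (real C) / real (n + q)) \<longlonglongrightarrow> h_top X" by simp
  have "(\<lambda>n. ln (real (l (n + q))) / real (n + q)) \<longlonglongrightarrow> h_top X"
  proof (rule real_tendsto_sandwich[OF _ _ lower upper])
    show "\<forall>\<^sub>F n in sequentially. ln (?c n) / real (n + q) \<le> ln (real (l (n + q))) / real (n + q)"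
      using eventually_gt_at_top[of 0]
    proof eventually_elim
      case (elim n)
      then have "ln (?c n) \<le> ln (real (l (n + q)))"
        using le[of n] pos[of n] by (intro ln_mono) auto
      then show ?case by (rule divide_right_mono) simp
    qed
    show "\<forall>\<^sub>F n in sequentially. ln (real (l (n + q))) / real (n + q)
        \<le> ln (?c n) / real (n + q) + ln (real C) / real (n + q)"
      using eventually_gt_at_top[of 0]
    proof eventually_elim
      case (elim n)
      have "0 < l (n + q)" using le[OF elim] pos[of n] by simp
      moreover have "real (l (n + q)) \<le> ?c n * real C"
        using ge[OF elim] by (simp flip: of_nat_mult)
      ultimately have "ln (real (l (n + q))) \<le> ln (?c n * real C)" by (intro ln_mono) auto
      also have "\<dots> = ln (?c n) + ln (real C)" using pos[of n] \<open>C > 0\<close> by (intro ln_mult_pos) auto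
      finally show ?case by (simp add: divide_right_mono flip: add_divide_distrib)
    qed
  qed
  then show ?thesis by (rule LIMSEQ_offset)
qed

text \<open>Along the subsequence \<open>k * N + a\<close> the quotients are at least
  \<open>k * ln 2 / (k * N + a)\<close>, which tends to \<open>ln 2 / N\<close>; the full limit is
  inherited by the subsequence.\<close>

lemma exponential_growth_rate_pos:
  fixes l :: "nat \<Rightarrow> nat"
  assumes lim: "(\<lambda>n. ln (real (l n)) / real n) \<longlonglongrightarrow> h"
    and "N > 0" and exp: "\<And>k. 2 ^ k \<le> l (k * N + a)"
  shows "h > 0"
proof -
  have "strict_mono (\<lambda>k. k * N + a)" using \<open>N > 0\<close> by (intro strict_monoI) simp
  from LIMSEQ_subseq_LIMSEQ[OF lim this]
  have "(\<lambda>k. ln (real (l (k * N + a))) / real (k * N + a)) \<longlonglongrightarrow> h" by (simp add: o_def)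
  moreover have "(\<lambda>k. real k * ln 2 / real (k * N + a)) \<longlonglongrightarrow> ln 2 / real N"
      proof -
    have "(\<lambda>k. real k * ln 2 / real (k * N + a)) \<longlonglongrightarrow> ln 2 * inverse (real N)"
      using \<open>N > 0\<close> by real_asymp
    then show ?thesis by (simp add: divide_inverse)
  qed
  moreover have "real k * ln 2 / real (k * N + a) \<le> ln (real (l (k * N + a))) / real (k * N + a)" for k
  proof -
    have "real k * ln 2 = ln (real (2 ^ k))" by (simp add: ln_realpow)
    also have "real (2 ^ k) \<le> real (l (k * N + a))" using exp of_nat_mono by blast
    then have "ln (real (2 ^ k)) \<le> ln (real (l (k * N + a)))" by (intro ln_mono) auto
    finally show ?thesis by (rule divide_right_mono) simp
  qed
  ultimately have "ln 2 / real N \<le> h" by (intro LIMSEQ_le) auto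
  moreover have "ln 2 / real N > 0" using \<open>N > 0\<close> by simp
  ultimately show ?thesis by linarith
qed

theorem theorem3p10:
  fixes F R :: "'a::finite list set"
    and m :: "'a list \<Rightarrow> nat"
    and p :: nat
  assumes "finite F" and "reduced F"
    and "\<forall>f\<in>F. length f \<ge> 2"
    and "\<forall>a. [a] \<in> language (forbidden_shift F)"
    and "irreducible_shift (forbidden_shift F)"
    and "repeated_words F R m"
    and "F \<union> R \<noteq> {}" and "p = Max (length ` (F \<union> R))" and "p \<ge> 2"
  shows "\<exists>A :: 'a list \<Rightarrow> 'a list \<Rightarrow> nat.
    let S = edge_shift (allowed_words F (p - 1)) A in
      language_within_Lambda F R m p A \<and>
      S \<noteq> {} \<and> convergent (entropy_seq S) \<and>
      (\<lambda>n. ln (real (size (Lambda F R m n))) / real n) \<longlonglongrightarrow> h_top S \<and>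
      (R \<noteq> {} \<longrightarrow> h_top S > 0)"
proof -
  define q where "q = p - 1"
  have p: "p = Suc q" "q > 0" using \<open>p \<ge> 2\<close> unfolding q_def by auto
  define A where "A = block_matrix F R m (Suc q)"
  define V where "V = allowed_words F q"
  define S where "S = edge_shift V A"
  have R: "finite R" "\<And>r. r \<in> R \<Longrightarrow> m r > 0"
    using assms(6) unfolding repeated_words_def by fastforce+
  have len: "length f \<le> Suc q" if "f \<in> F \<union> R" for f
    using that \<open>finite F\<close> R(1) unfolding p(1)[symmetric] assms(8) by auto
  have lenF: "length f \<le> Suc q" if "f \<in> F" for f using len that by blast
  have lenR: "length r \<le> Suc q" if "r \<in> R" for r using len that by blast
  note bounds = card_language_edge_shift_bounds[where F = F and R = R and m = m, OF p(2) lenF lenR R(2),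
      folded V_def A_def, folded S_def]
  obtain x where x: "x \<in> forbidden_shift F"
    using assms(4) unfolding language_def by auto
  \<comment> \<open>The path without edges at the first block of \<open>x\<close> extends to an
    infinite path, so the edge shift has a point.\<close>
  have "[] \<in> edge_paths_along V A (blocks q (map x [0..<0 + q]))"
    unfolding blocks_prefix by (simp add: edge_paths_along_def)
  then obtain e where "e \<in> S"
    using edge_path_extends[OF x p(2), of R m "[]" 0] R(2) unfolding S_def V_def A_def by blast
  then have "S \<noteq> {}" by blast
  have pos: "card (language_of_length S n) > 0" for n
  proof -
    have "map e [0..<n] \<in> language_of_length S n"
      using \<open>e \<in> S\<close> by (simp add: language_of_length_def prefix_in_language)
    then show ?thesis using bounds(1) card_gt_0_iff by blast
  qed
  have conv: "convergent (entropy_seq S)"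
    using bounds(1) \<open>S \<noteq> {}\<close> by (rule entropy_seq_convergent)
  have lim: "(\<lambda>n. ln (real (size (Lambda F R m n))) / real n) \<longlonglongrightarrow> h_top S"
    using entropy_seq_comparison[OF conv pos bounds(3,4)] by blast
  have "h_top S > 0" if nonempty: "R \<noteq> {}"
  proof -
    obtain r where "r \<in> R" using nonempty by blast
    then show ?thesis
      using size_Lambda_exponential[OF assms(5,6) _ _ lenF]
        exponential_growth_rate_pos[OF lim] by (metis zero_less_Suc)
  qed
  moreover have "language_within_Lambda F R m p A"
    unfolding language_within_Lambda_def q_def[symmetric] V_def[symmetric]
  proof (intro conjI ballI allI impI)
    fix X Y assume "A X Y \<noteq> 0"
    then show "\<exists>w\<in>allowed_words F p. word_star X Y = Some w"
      unfolding A_def block_matrix_def p(1) by (auto split: option.splits if_splits)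
  next
    \<comment> \<open>The bound is stated for length \<open>n + q\<close>; here
      \<open>p \<le> n\<close> gives \<open>n - q + q = n\<close>.\<close>
    fix n w assume "p \<le> n" "w \<in> allowed_words F n"
    then show "card (edge_paths_along V A (blocks q w)) \<le> word_mult R m w"
      using bounds(2)[of w "n - q"] p(1) by simp
  qed
  ultimately show ?thesis
    using \<open>S \<noteq> {}\<close> conv lim unfolding Let_def q_def[symmetric] V_def[symmetric] S_def by blast
qed

end
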